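(* There are no mod-shifters for $k\ge3$. In other words: let $n\ge1$ and $k\ge 1$ be integers, let $j\in\{0,1,\ldots,k-1\}$, and let $G$ be a permutation of $\{0,1\}^n$ such that $|G(x)|\equiv|x|+j\pmod k$ for all $x\in\{0,1\}^n$. Then either $j=0$ or $k=2$.
   Context: $|x|$ denotes the Hamming weight of a bit string $x$. A mod-shifter for $k$ is a permutation $G$ of $\{0,1\}^n$ for which there is a fixed $j\not\equiv0\pmod k$ with $|G(x)|\equiv|x|+j\pmod k$ for all $x$. *)

theory Defs
  imports Main "HOL-Number_Theory.Cong"
begin

definition bitstrings :: "nat \<Rightarrow> bool list set" where
  "bitstrings n = {x. length x = n}"

definition hamming_weight :: "bool list \<Rightarrow> nat" where
  "hamming_weight x = count_list x True"

text \<open>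
  A permutation of the length-\<open>n\<close> strings is rendered as a bijection of the carrier
  set; the values of \<open>G\<close> on strings of other lengths are irrelevant.
\<close>

definition mod_shifter :: "nat \<Rightarrow> nat \<Rightarrow> (bool list \<Rightarrow> bool list) \<Rightarrow> bool" where
  "mod_shifter n k G \<longleftrightarrow>
     bij_betw G (bitstrings n) (bitstrings n) \<and>
     (\<exists>j::int. \<not> [j = 0] (mod int k) \<and>
        (\<forall>x\<in>bitstrings n. [int (hamming_weight (G x)) = int (hamming_weight x) + j] (mod int k)))"

end

theory Submission
  imports Defs Complex_Main
begin

text \<open>
  For \<open>z\<close> with \<open>z ^ k = 1\<close>, reindexing the weight enumerator
  \<open>(\<Sum>x. z ^ |x|) = (1 + z) ^ n\<close> along \<open>G\<close> multiplies it by \<open>z ^ j\<close>. Taking for \<open>z\<close> a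
  primitive \<open>k\<close>-th root of unity, either \<open>z ^ j = 1\<close>, so \<open>j = 0\<close>, or \<open>1 + z = 0\<close>, which
  for \<open>k \<ge> 3\<close> contradicts \<open>z\<^sup>2 \<noteq> 1\<close>.
\<close>

lemma finite_bitstrings: "finite (bitstrings n)"
  using finite_lists_length_eq[of "UNIV :: bool set" n] by (simp add: bitstrings_def)

lemma bitstrings_0: "bitstrings 0 = {[]}"
  by (auto simp: bitstrings_def)

lemma bitstrings_Suc:
  "bitstrings (Suc n) = (#) True ` bitstrings n \<union> (#) False ` bitstrings n"
proof (intro equalityI subsetI)
  fix x assume "x \<in> bitstrings (Suc n)"
  then obtain b y where "x = b # y" "y \<in> bitstrings n"
    by (auto simp: bitstrings_def length_Suc_conv)
  then show "x \<in> (#) True ` bitstrings n \<union> (#) False ` bitstrings n"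
    by (cases b) auto
qed (auto simp: bitstrings_def)

text \<open>Induction on \<open>n\<close> by splitting off the first bit: a leading
  \<open>True\<close> contributes a factor \<open>z\<close>, a leading \<open>False\<close> a factor
  1, so each bit multiplies the sum by \<open>1 + z\<close>.\<close>

lemma sum_power_hamming_weight:
  fixes z :: "'a :: comm_ring_1"
  shows "(\<Sum>x\<in>bitstrings n. z ^ hamming_weight x) = (1 + z) ^ n"
proof (induction n)
  case 0
  show ?case by (simp add: bitstrings_0 hamming_weight_def)
next
  case (Suc n)
  have "(\<Sum>x\<in>bitstrings (Suc n). z ^ hamming_weight x) =
      (\<Sum>x\<in>(#) True ` bitstrings n. z ^ hamming_weight x) +
      (\<Sum>x\<in>(#) False ` bitstrings n. z ^ hamming_weight x)"
    unfolding bitstrings_Suc by (rule sum.union_disjoint) (auto simp: finite_bitstrings)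
  also have "\<dots> = z * (\<Sum>x\<in>bitstrings n. z ^ hamming_weight x) +
      (\<Sum>x\<in>bitstrings n. z ^ hamming_weight x)"
    by (simp add: sum.reindex hamming_weight_def sum_distrib_left)
  also have "\<dots> = (1 + z) ^ Suc n"
    by (simp add: Suc.IH algebra_simps)
  finally show ?case .
qed

text \<open>This turns the congruence between weights into an equality of summands.\<close>

lemma power_eq_power_if_cong:
  fixes z :: "'a :: monoid_mult"
  assumes "z ^ k = 1" and "[a = b] (mod k)"
  shows "z ^ a = z ^ b"
proof -
  have mod: "z ^ m = z ^ (m mod k)" for m
  proof -
    have "z ^ m = z ^ (k * (m div k) + m mod k)" by simp
    also have "\<dots> = z ^ (m mod k)" by (simp only: power_add power_mult assms(1)) simp
    finally show ?thesis .
  qed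
  show ?thesis using assms(2) mod[of a] mod[of b] by (simp add: cong_def)
qed

lemma exists_primitive_root_of_unity:
  fixes k :: nat
  assumes "k \<ge> 1"
  obtains z :: complex where "z ^ k = 1" and "\<And>m. \<lbrakk>0 < m; m < k\<rbrakk> \<Longrightarrow> z ^ m \<noteq> 1"
proof
  let ?z = "cis (2 * pi / real k)"
  have bij: "bij_betw (\<lambda>m. cis (2 * pi * real m / real k)) {..<k} {z. z ^ k = 1}"
    using bij_betw_roots_unity[of k] assms by simp
  have power: "?z ^ m = cis (2 * pi * real m / real k)" for m
    by (simp add: DeMoivre mult_ac)
  show "?z ^ k = 1" using assms by (simp add: power)
  show "?z ^ m \<noteq> 1" if "0 < m" "m < k" for m
    \<comment> \<open>Index 0 enumerates the root 1, so by injectivity no other index below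
      \<open>k\<close> does.\<close>
    using inj_onD[OF bij_betw_imp_inj_on[OF bij], of m 0] that by (auto simp: power)
qed

text \<open>Common core of both halves of the theorem, with the shift normalized to a natural number
  below \<open>k\<close>.\<close>

lemma weight_shift_trivial:
  fixes n k j :: nat
  assumes "j < k" and bij: "bij_betw G (bitstrings n) (bitstrings n)"
    and shift: "\<forall>x\<in>bitstrings n. [hamming_weight (G x) = hamming_weight x + j] (mod k)"
  shows "j = 0 \<or> k = 2"
proof (rule ccontr)
  assume "\<not> (j = 0 \<or> k = 2)"
  \<comment> \<open>A nonzero \<open>j\<close> below \<open>k\<close> also excludes
    \<open>k = 1\<close>.\<close>
  with \<open>j < k\<close> have "0 < j" "k \<ge> 3" by auto
  obtain z :: complex where z: "z ^ k = 1" and prim: "\<And>m. \<lbrakk>0 < m; m < k\<rbrakk> \<Longrightarrow> z ^ m \<noteq> 1"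
    using exists_primitive_root_of_unity[of k] \<open>k \<ge> 3\<close> by auto
  have "(1 + z) ^ n = (\<Sum>x\<in>bitstrings n. z ^ hamming_weight (G x))"
    using sum.reindex_bij_betw[OF bij, of "\<lambda>x. z ^ hamming_weight x"]
    by (simp add: sum_power_hamming_weight)
  also have "\<dots> = (\<Sum>x\<in>bitstrings n. z ^ (hamming_weight x + j))"
    using shift by (intro sum.cong refl power_eq_power_if_cong[OF z]) auto
  also have "\<dots> = (1 + z) ^ n * z ^ j"
    by (simp add: power_add flip: sum_power_hamming_weight sum_distrib_right)
  \<comment> \<open>Since \<open>z ^ j\<close> differs from 1, the factor \<open>(1 + z) ^ n\<close>
    must vanish.\<close>
  finally have "1 + z = 0"
    using prim[OF \<open>0 < j\<close> \<open>j < k\<close>] by auto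
  \<comment> \<open>Here \<open>z = -1\<close>, whose order 2 is too small for a primitive root as 2
    < \<open>k\<close>.\<close>
  then have "z ^ 2 = 1" by (simp add: add_eq_0_iff)
  with prim[of 2] \<open>k \<ge> 3\<close> show False by simp
qed

theorem theorem12:
  fixes n k :: nat
  assumes "n \<ge> 1" and "k \<ge> 1"
  shows "(k \<ge> 3 \<longrightarrow> \<not> (\<exists>G. mod_shifter n k G)) \<and>
    (\<forall>j\<in>{0..<k}. \<forall>G.
       bij_betw G (bitstrings n) (bitstrings n) \<and>
       (\<forall>x\<in>bitstrings n. [hamming_weight (G x) = hamming_weight x + j] (mod k))
       \<longrightarrow> j = 0 \<or> k = 2)"
proof (intro conjI impI notI)
  assume "k \<ge> 3" and "\<exists>G. mod_shifter n k G"
  then obtain G j where bij: "bij_betw G (bitstrings n) (bitstrings n)"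
    and j: "\<not> [j = 0] (mod int k)"
    and shift: "\<forall>x\<in>bitstrings n.
      [int (hamming_weight (G x)) = int (hamming_weight x) + j] (mod int k)"
    by (auto simp: mod_shifter_def)
  \<comment> \<open>The shift of a mod-shifter is an arbitrary integer; its least nonnegative
    residue fits the lemma on natural shifts.\<close>
  define i where "i = nat (j mod int k)"
  have i: "int i = j mod int k" using \<open>k \<ge> 3\<close> by (simp add: i_def)
  then have "int i < int k" using \<open>k \<ge> 3\<close> by simp
  then have "i < k" by simp
  moreover have "[hamming_weight (G x) = hamming_weight x + i] (mod k)"
    if "x \<in> bitstrings n" for x
  proof -
    have "[int (hamming_weight (G x)) = int (hamming_weight x + i)] (mod int k)"
      using shift that by (simp add: i cong_def mod_add_right_eq)
    then show ?thesis by (simp only: cong_int_iff)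
  qed
  ultimately have "i = 0 \<or> k = 2"
    using weight_shift_trivial[OF _ bij] by blast
  \<comment> \<open>The case \<open>i = 0\<close> would make \<open>j\<close> divisible by
    \<open>k\<close>.\<close>
  with i j \<open>k \<ge> 3\<close> show False by (auto simp: cong_def)
next
  show "\<forall>j\<in>{0..<k}. \<forall>G.
       bij_betw G (bitstrings n) (bitstrings n) \<and>
       (\<forall>x\<in>bitstrings n. [hamming_weight (G x) = hamming_weight x + j] (mod k))
       \<longrightarrow> j = 0 \<or> k = 2"
    using weight_shift_trivial by (meson atLeastLessThan_iff)
qed

end
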